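(* Consider the robust peak load pricing model with fixed demand and uncertain variable costs, with uncertainty set $\mathcal{U}$ (all defined in the context). Then $$C_R\le E_R\le\frac{1}{\tau(\mathcal{U})}\,C_R .$$ This bound is sharp in the sense that for any $\delta>0$ there exist instances of the model such that $$E_R\ge\frac{1-\delta}{\tau(\mathcal{U})}\,C_R .$$
   Context: Let $\mathcal{N}=\{1,\dots,N\}$ (producers) and $\mathcal{T}=\{1,\dots,T\}$ (time periods). An instance consists of: investment costs $c^{\mathrm{inv}}_i\ge 0$, nominal variable costs $c^{\mathrm{var}}_i\ge 0$, scaling factors $a_i\ge 0$ ($i\in\mathcal{N}$), fixed demands $d_t\ge 0$ ($t\in\mathcal{T}$), and an uncertainty set $\mathcal{U}\subseteq[0,1]^{N\times T}$ which is a convex polytope with $0\in\mathcal{U}$, whose projection onto every coordinate axis is $[0,1]$, and which is a Cartesian product $\mathcal{U}=\prod_{t\in\mathcal{T}}\mathcal{U}'$ for some $\mathcal{U}'\subseteq[0,1]^N$. The uncertain variable costs are $c^{\mathrm{var}}_i+a_iu_{i,t}$, $u\in\mathcal{U}$. Feasible set: $F=\{(x,y) : x\in\mathbb{R}^{N\times T}_{\ge 0},\ y\in\mathbb{R}^N_{\ge 0},\ x_{i,t}\le y_i\ \forall i,t,\ \sum_{i\in\mathcal{N}}x_{i,t}=d_t\ \forall t\}$. Robust market equilibrium: an optimal solution $(x^*,y^* )$ of $\min_{(x,y)\in F}\sum_{i\in\mathcal{N}}\big(c^{\mathrm{inv}}_iy_i+\sum_{t\in\mathcal{T}}(c^{\mathrm{var}}_i+a_i)x_{i,t}\big)$.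 For any such optimal solution, its worst-case total cost is $E_R:=\max_{u\in\mathcal{U}}\sum_{i\in\mathcal{N}}\big(c^{\mathrm{inv}}_iy^*_i+\sum_{t\in\mathcal{T}}(c^{\mathrm{var}}_i+a_iu_{i,t})x^*_{i,t}\big)$. Robust central planner: $C_R:=\min_{(x,y)\in F}\max_{u\in\mathcal{U}}\sum_{i\in\mathcal{N}}\big(c^{\mathrm{inv}}_iy_i+\sum_{t\in\mathcal{T}}(c^{\mathrm{var}}_i+a_iu_{i,t})x_{i,t}\big)$. $\tau(\mathcal{U}):=\max\{\tau\in\mathbb{R} : \exists u\in\mathcal{U}\text{ with }\tau\le u_{i,t}\ \forall i,t\}$. *)

theory Defs
  imports "HOL-Analysis.Analysis"
begin

text \<open>
  Producers are the elements of the finite type \<open>'n\<close> and time periods those of the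
  finite type \<open>'t\<close>. A matrix indexed by producers and periods is a vector of
  per-period vectors, so the entry for producer \<open>i\<close> and period \<open>t\<close> of \<open>u\<close> is
  \<open>u $ t $ i\<close>.
\<close>

record ('n::finite, 't::finite) plp_data =
  c_inv :: "real ^ 'n"
  c_var :: "real ^ 'n"
  scaling :: "real ^ 'n"
  demand :: "real ^ 't"

definition nonneg_data :: "('n::finite, 't::finite) plp_data \<Rightarrow> bool" where
  "nonneg_data p \<longleftrightarrow>
     (\<forall>i. 0 \<le> c_inv p $ i \<and> 0 \<le> c_var p $ i \<and> 0 \<le> scaling p $ i) \<and> (\<forall>t. 0 \<le> demand p $ t)"

definition uncertainty_set :: "(real ^ 'n ^ 't) set \<Rightarrow> bool" where
  "uncertainty_set U \<longleftrightarrow>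
     polytope U \<and> 0 \<in> U \<and>
     (\<forall>t i. (\<lambda>u. u $ t $ i) ` U = {0..1}) \<and>
     (\<exists>U'. (\<forall>v\<in>U'. \<forall>i. 0 \<le> v $ i \<and> v $ i \<le> 1) \<and> U = {u. \<forall>t. u $ t \<in> U'})"

definition feasible :: "('n::finite, 't::finite) plp_data \<Rightarrow> ((real ^ 'n ^ 't) \<times> (real ^ 'n)) set" where
  "feasible p = {(x, y). (\<forall>t i. 0 \<le> x $ t $ i) \<and> (\<forall>i. 0 \<le> y $ i) \<and>
     (\<forall>t i. x $ t $ i \<le> y $ i) \<and> (\<forall>t. (\<Sum>i\<in>UNIV. x $ t $ i) = demand p $ t)}"

definition total_cost ::
  "('n::finite, 't::finite) plp_data \<Rightarrow> real ^ 'n ^ 't \<Rightarrow> (real ^ 'n ^ 't) \<times> (real ^ 'n) \<Rightarrow> real" where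
  "total_cost p u = (\<lambda>(x, y). \<Sum>i\<in>UNIV. c_inv p $ i * y $ i +
     (\<Sum>t\<in>UNIV. (c_var p $ i + scaling p $ i * u $ t $ i) * x $ t $ i))"

definition market_cost ::
  "('n::finite, 't::finite) plp_data \<Rightarrow> (real ^ 'n ^ 't) \<times> (real ^ 'n) \<Rightarrow> real" where
  "market_cost p = (\<lambda>(x, y). \<Sum>i\<in>UNIV. c_inv p $ i * y $ i +
     (\<Sum>t\<in>UNIV. (c_var p $ i + scaling p $ i) * x $ t $ i))"

definition robust_equilibrium ::
  "('n::finite, 't::finite) plp_data \<Rightarrow> (real ^ 'n ^ 't) \<times> (real ^ 'n) \<Rightarrow> bool" where
  "robust_equilibrium p z \<longleftrightarrow> is_arg_min (market_cost p) (\<lambda>z. z \<in> feasible p) z"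

text \<open>
  The maxima and the minimum of the model are written as suprema and an infimum;
  \<open>worst_case_cost_attained\<close>, \<open>planner_cost_attained\<close> and \<open>tau_attained\<close> below show that
  they are attained. \<open>E\<^sub>R\<close> is \<open>worst_case_cost\<close> evaluated at a robust equilibrium, and
  \<open>C\<^sub>R\<close> is \<open>planner_cost\<close>.
\<close>

definition worst_case_cost ::
  "('n::finite, 't::finite) plp_data \<Rightarrow> (real ^ 'n ^ 't) set \<Rightarrow> (real ^ 'n ^ 't) \<times> (real ^ 'n) \<Rightarrow> real" where
  "worst_case_cost p U z = (SUP u\<in>U. total_cost p u z)"

definition planner_cost :: "('n::finite, 't::finite) plp_data \<Rightarrow> (real ^ 'n ^ 't) set \<Rightarrow> real" where
  "planner_cost p U = (INF z\<in>feasible p. worst_case_cost p U z)"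

definition tau :: "(real ^ 'n ^ 't) set \<Rightarrow> real" where
  "tau U = Sup {r. \<exists>u\<in>U. \<forall>t i. r \<le> u $ t $ i}"

lemma uncertainty_set_compact: "uncertainty_set U \<Longrightarrow> compact U"
  by (simp add: uncertainty_set_def polytope_imp_compact)

lemma uncertainty_set_nonempty: "uncertainty_set U \<Longrightarrow> U \<noteq> {}"
  by (auto simp: uncertainty_set_def)

lemma continuous_on_total_cost: "continuous_on S (\<lambda>u. total_cost p u z)"
  unfolding total_cost_def case_prod_beta by (intro continuous_intros)

lemma continuous_on_total_cost': "continuous_on S (\<lambda>z. total_cost p u z)"
  unfolding total_cost_def case_prod_beta by (intro continuous_intros)

lemma worst_case_cost_attained:
  assumes "uncertainty_set U"
  shows "\<exists>u\<in>U. worst_case_cost p U z = total_cost p u z \<and> (\<forall>v\<in>U. total_cost p v z \<le> total_cost p u z)"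
proof -
  obtain u where u: "u \<in> U" "\<forall>v\<in>U. total_cost p v z \<le> total_cost p u z"
    using continuous_attains_sup[OF uncertainty_set_compact[OF assms]
        uncertainty_set_nonempty[OF assms] continuous_on_total_cost] by blast
  have "worst_case_cost p U z = total_cost p u z"
    unfolding worst_case_cost_def using u by (intro cSup_eq_maximum) auto
  with u show ?thesis by blast
qed

lemma tau_attained:
  assumes "uncertainty_set (U :: (real ^ 'n::finite ^ 't::finite) set)"
  shows "\<exists>u\<in>U. (\<forall>t i. tau U \<le> u $ t $ i) \<and> (\<forall>r. (\<exists>v\<in>U. \<forall>t i. r \<le> v $ t $ i) \<longrightarrow> r \<le> tau U)"
proof -
  define m where "m u = Min (range (\<lambda>(t, i). u $ t $ i))" for u :: "real ^ 'n ^ 't"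
  have mle: "r \<le> m u \<longleftrightarrow> (\<forall>t i. r \<le> u $ t $ i)" for r u
    unfolding m_def by (subst Min_ge_iff) auto
  have lip: "m u \<le> m v + dist u v" for u v
  proof -
    have "u $ t $ i \<le> v $ t $ i + dist u v" for t i
    proof -
      have "dist (u $ t $ i) (v $ t $ i) \<le> dist u v"
        using dist_vec_nth_le[of "u $ t" i "v $ t"] dist_vec_nth_le[of u t v] by linarith
      then show ?thesis by (simp add: dist_real_def)
    qed
    then have "m u - dist u v \<le> v $ t $ i" for t i
      using mle[of "m u" u] by (smt (verit))
    then show ?thesis using mle[of "m u - dist u v" v] by force
  qed
  have "continuous_on U m"
  proof (unfold continuous_on_iff, intro ballI allI impI)
    fix u and e :: real assume "0 < e"
    moreover have "dist (m v) (m u) \<le> dist v u" for v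
      using lip[of u v] lip[of v u] dist_commute[of u v]
      unfolding dist_real_def[of "m v"] by linarith
    ultimately show "\<exists>d>0. \<forall>v\<in>U. dist v u < d \<longrightarrow> dist (m v) (m u) < e"
      by (meson le_less_trans)
  qed
  then obtain u where u: "u \<in> U" "\<forall>v\<in>U. m v \<le> m u"
    using continuous_attains_sup[OF uncertainty_set_compact[OF assms]
        uncertainty_set_nonempty[OF assms]] by blast
  have max: "r \<le> m u" if "\<exists>v\<in>U. \<forall>t i. r \<le> v $ t $ i" for r
    using that u mle by (meson order_trans)
  have "tau U = m u"
    unfolding tau_def using u max mle by (intro cSup_eq_maximum) auto
  then show ?thesis using u max mle by (metis order_refl)
qed

lemma tau_pos:
  assumes "uncertainty_set (U :: (real ^ 'n::finite ^ 't::finite) set)"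
  shows "0 < tau U"
proof -
  have "\<exists>u\<in>U. u $ t $ i = 1" for t i
  proof -
    have "1 \<in> (\<lambda>u. u $ t $ i) ` U" using assms by (simp add: uncertainty_set_def)
    then show ?thesis by auto
  qed
  then obtain w where w: "\<And>t i. w t i \<in> U" "\<And>t i. w t i $ t $ i = 1" by metis
  define I where "I = (UNIV :: ('t \<times> 'n) set)"
  define u where "u = (\<Sum>k\<in>I. (1 / real (card I)) *\<^sub>R w (fst k) (snd k))"
  have I: "finite I" "card I > 0" by (auto simp: I_def card_gt_0_iff)
  have cvx: "convex U" using assms by (simp add: uncertainty_set_def polytope_imp_convex)
  have uU: "u \<in> U"
    unfolding u_def using I w cvx by (intro convex_sum) auto
  have nn: "0 \<le> v $ t $ i" if "v \<in> U" for v t i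
    using that assms by (auto simp: uncertainty_set_def)
  have "1 / real (card I) \<le> u $ t $ i" for t i
  proof -
    have "1 / real (card I) = (1 / real (card I)) * w t i $ t $ i" by (simp add: w)
    also have "\<dots> \<le> (\<Sum>k\<in>I. (1 / real (card I)) * w (fst k) (snd k) $ t $ i)"
      using member_le_sum[of "(t, i)" I "\<lambda>k. (1 / real (card I)) * w (fst k) (snd k) $ t $ i"] I nn w
      by (auto simp: I_def)
    also have "\<dots> = u $ t $ i" by (simp add: u_def)
    finally show ?thesis .
  qed
  then have "1 / real (card I) \<le> tau U" using tau_attained[OF assms] uU by blast
  moreover have "0 < 1 / real (card I)" using I by simp
  ultimately show ?thesis by linarith
qed

lemma total_cost_affine:
  "total_cost p u ((1 - s) *\<^sub>R z + s *\<^sub>R w) = (1 - s) * total_cost p u z + s * total_cost p u w"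
  unfolding total_cost_def case_prod_beta
  by (simp add: sum.distrib sum_distrib_left algebra_simps sum_subtractf)

lemma continuous_on_worst_case_cost:
  assumes U: "uncertainty_set U"
  shows "continuous_on S (worst_case_cost p U)"
proof -
  have le: "total_cost p u z \<le> worst_case_cost p U z" if "u \<in> U" for u z
    using worst_case_cost_attained[OF U, of p z] that by auto
  have "convex_on UNIV (worst_case_cost p U)"
  proof (intro convex_onI)
    fix s :: real and z w assume s: "0 < s" "s < 1"
    obtain u where u: "u \<in> U"
      "worst_case_cost p U ((1 - s) *\<^sub>R z + s *\<^sub>R w) = total_cost p u ((1 - s) *\<^sub>R z + s *\<^sub>R w)"
      using worst_case_cost_attained[OF U] by blast
    show "worst_case_cost p U ((1 - s) *\<^sub>R z + s *\<^sub>R w)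
      \<le> (1 - s) * worst_case_cost p U z + s * worst_case_cost p U w"
      unfolding u(2) total_cost_affine using s le[OF u(1)]
      by (intro add_mono mult_left_mono) auto
  qed simp
  then have "continuous_on UNIV (worst_case_cost p U)"
    by (intro convex_on_continuous) auto
  then show ?thesis using continuous_on_subset by blast
qed

lemma feasible_min_attained:
  fixes p :: "('n::finite, 't::finite) plp_data"
  assumes p: "nonneg_data p"
    and cont: "continuous_on UNIV f"
    and mono: "\<And>x y y'. (\<And>i. y $ i \<le> y' $ i) \<Longrightarrow> f (x, y) \<le> (f (x, y') :: real)"
  shows "\<exists>z\<in>feasible p. \<forall>w\<in>feasible p. f z \<le> f w"
proof -
  define D where "D = (\<Sum>t\<in>UNIV. demand p $ t)"
  have dn: "0 \<le> demand p $ t" for t using p by (simp add: nonneg_data_def)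
  have dD: "demand p $ t \<le> D" for t
    unfolding D_def using dn by (intro member_le_sum) auto
  have D0: "0 \<le> D" unfolding D_def using dn by (intro sum_nonneg) auto
  define K where "K = {z \<in> feasible p. \<forall>i. snd z $ i \<le> D}"
  have xle: "x $ t $ i \<le> D" if "(x, y) \<in> feasible p" for x y t i
  proof -
    have "x $ t $ i \<le> (\<Sum>i\<in>UNIV. x $ t $ i)"
      using that by (intro member_le_sum) (auto simp: feasible_def)
    then show ?thesis using that dD[of t] by (auto simp: feasible_def)
  qed
  have "closed (feasible p)"
    unfolding feasible_def case_prod_beta
    by (intro closed_Collect_conj closed_Collect_all closed_Collect_le closed_Collect_eq continuous_intros)
  moreover have "closed {z :: (real ^ 'n ^ 't) \<times> (real ^ 'n). \<forall>i. snd z $ i \<le> D}"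
    by (intro closed_Collect_all closed_Collect_le continuous_intros)
  moreover have "K = feasible p \<inter> {z. \<forall>i. snd z $ i \<le> D}" by (auto simp: K_def)
  ultimately have "closed K" by auto
  moreover have "K \<subseteq> cbox 0 (\<chi> t i. D) \<times> cbox 0 (\<chi> i. D)"
  proof
    fix z assume z: "z \<in> K"
    then show "z \<in> cbox 0 (\<chi> t i. D) \<times> cbox 0 (\<chi> i. D)"
      using xle[of "fst z" "snd z"]
      by (auto simp: K_def feasible_def mem_box_cart less_eq_vec_def cbox_interval)
  qed
  then have "bounded K" using bounded_Times bounded_cbox bounded_subset by metis
  ultimately have "compact K" by (simp add: compact_eq_bounded_closed)
  moreover have "K \<noteq> {}"
  proof -
    have "((\<chi> t i. demand p $ t / real CARD('n)), (\<chi> i. D)) \<in> K"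
    proof -
      have "demand p $ t / real CARD('n) \<le> D" for t
      proof -
        have "real CARD('n) \<ge> 1" by (simp add: Suc_leI)
        then have "demand p $ t / real CARD('n) \<le> demand p $ t"
          using dn[of t] by (simp add: divide_le_eq mult_right_mono[of 1, simplified] mult_le_cancel_left1)
        then show ?thesis using dD[of t] by linarith
      qed
      then show ?thesis using dn D0 by (simp add: K_def feasible_def)
    qed
    then show ?thesis by blast
  qed
  ultimately obtain z where z: "z \<in> K" "\<forall>w\<in>K. f z \<le> f w"
    using continuous_attains_inf[of K f] cont continuous_on_subset by blast
  have "f z \<le> f w" if w: "w \<in> feasible p" for w
  proof -
    obtain x y where xy: "w = (x, y)" by force
    define y' where "y' = (\<chi> i. min (y $ i) D)"
    have "(x, y') \<in> K"
      using w xle[of x y] D0 unfolding xy K_def feasible_def y'_def by auto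
    then have "f z \<le> f (x, y')" using z by blast
    also have "\<dots> \<le> f (x, y)" by (rule mono) (simp add: y'_def)
    finally show ?thesis by (simp add: xy)
  qed
  moreover have "z \<in> feasible p" using z by (simp add: K_def)
  ultimately show ?thesis by blast
qed

lemma planner_cost_attained:
  assumes p: "nonneg_data p" and U: "uncertainty_set U"
  shows "\<exists>z\<in>feasible p. planner_cost p U = worst_case_cost p U z \<and>
           (\<forall>w\<in>feasible p. worst_case_cost p U z \<le> worst_case_cost p U w)"
proof -
  have mono: "worst_case_cost p U (x, y) \<le> worst_case_cost p U (x, y')" if y: "\<And>i. y $ i \<le> y' $ i" for x y y'
  proof -
    obtain u where u: "u \<in> U" "worst_case_cost p U (x, y) = total_cost p u (x, y)"
      using worst_case_cost_attained[OF U] by blast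
    have "total_cost p u (x, y) \<le> total_cost p u (x, y')"
      unfolding total_cost_def prod.case using p y
      by (intro sum_mono add_mono mult_left_mono order_refl) (auto simp: nonneg_data_def)
    also have "\<dots> \<le> worst_case_cost p U (x, y')"
      using worst_case_cost_attained[OF U, of p "(x, y')"] u by auto
    finally show ?thesis by (simp add: u)
  qed
  obtain z where z: "z \<in> feasible p" "\<forall>w\<in>feasible p. worst_case_cost p U z \<le> worst_case_cost p U w"
    using feasible_min_attained[OF p continuous_on_worst_case_cost[OF U] mono] by blast
  have "planner_cost p U = worst_case_cost p U z"
    unfolding planner_cost_def using z by (intro cInf_eq_minimum) auto
  with z show ?thesis by blast
qed

lemma robust_equilibrium_exists:
  assumes p: "nonneg_data p"
  shows "\<exists>z. robust_equilibrium p z"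
proof -
  have "continuous_on UNIV (market_cost p)"
    unfolding market_cost_def case_prod_beta by (intro continuous_intros)
  moreover have "market_cost p (x, y) \<le> market_cost p (x, y')" if "\<And>i. y $ i \<le> y' $ i" for x y y'
    unfolding market_cost_def prod.case using p that
    by (intro sum_mono add_mono mult_left_mono order_refl) (auto simp: nonneg_data_def)
  ultimately obtain z where "z \<in> feasible p" "\<forall>w\<in>feasible p. market_cost p z \<le> market_cost p w"
    using feasible_min_attained[OF p, of "market_cost p"] by blast
  then show ?thesis
    unfolding robust_equilibrium_def is_arg_min_linorder by blast
qed

end

(* Upper bound: the market cost prices every entry of u at 1, hence dominates the worst-case
   cost, while at a point of U with all entries at least tau the total cost is at least tau
   times the market cost.

   Sharpness, for every uncertainty set: put all investment and nominal costs to 0 and give one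
   producer j scaling factor 1, all others 1 + delta. Every equilibrium then uses j only, and by
   the product structure all its costs can be raised to 1 simultaneously, so the worst-case cost
   is the total demand. The planner spreads production according to a dual certificate of tau,
   obtained by separating U from the open orthant above tau; demands are the row sums of it. *)
theory Submission
  imports Defs
begin

section \<open>Upper bound on the equilibrium cost\<close>

lemma uncertainty_set_bounds:
  assumes "uncertainty_set U" "u \<in> U"
  shows "0 \<le> u $ t $ i" "u $ t $ i \<le> 1"
  using assms by (auto simp: uncertainty_set_def)

lemma total_cost_le_worst_case_cost:
  assumes "uncertainty_set U" "u \<in> U"
  shows "total_cost p u z \<le> worst_case_cost p U z"
  using worst_case_cost_attained[OF assms(1), of p z] assms(2) by auto

lemma tau_le_1:
  assumes "uncertainty_set U"
  shows "tau U \<le> 1"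
  using tau_attained[OF assms] uncertainty_set_bounds(2)[OF assms] order_trans by blast

lemma worst_case_cost_le_market_cost:
  assumes p: "nonneg_data p" and U: "uncertainty_set U" and z: "z \<in> feasible p"
  shows "worst_case_cost p U z \<le> market_cost p z"
proof -
  obtain u where u: "u \<in> U" "worst_case_cost p U z = total_cost p u z"
    using worst_case_cost_attained[OF U] by blast
  obtain x y where xy: "z = (x, y)" by force
  show ?thesis
    unfolding u(2)
    unfolding xy total_cost_def market_cost_def prod.case
    using p z uncertainty_set_bounds(2)[OF U u(1)]
    by (intro sum_mono add_mono mult_right_mono order_refl)
      (auto simp: nonneg_data_def feasible_def xy mult_left_le)
qed

text \<open>A single maximizer \<open>u\<close> from \<open>tau_attained\<close> serves every plan:
  \<open>u\<close> \<ge> \<open>tau U\<close> handles the scaling terms, and \<open>tau U\<close>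
  \<le> 1 handles the investment and nominal terms.\<close>

lemma tau_market_cost_le_worst_case_cost:
  assumes p: "nonneg_data p" and U: "uncertainty_set U" and z: "z \<in> feasible p"
  shows "tau U * market_cost p z \<le> worst_case_cost p U z"
proof -
  obtain u where u: "u \<in> U" "\<And>t i. tau U \<le> u $ t $ i"
    using tau_attained[OF U] by blast
  obtain x y where xy: "z = (x, y)" by force
  note tau = tau_pos[OF U] tau_le_1[OF U]
  have nn: "0 \<le> c_inv p $ i" "0 \<le> c_var p $ i" "0 \<le> scaling p $ i"
      "0 \<le> x $ t $ i" "0 \<le> y $ i" for t i
    using p z by (auto simp: nonneg_data_def feasible_def xy)
  have "tau U * (c_inv p $ i * y $ i) \<le> c_inv p $ i * y $ i" for i
    using nn(1)[of i] nn(5)[of i] tau by (intro mult_left_le_one_le) auto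
  moreover have "tau U * ((c_var p $ i + scaling p $ i) * x $ t $ i)
      \<le> (c_var p $ i + scaling p $ i * u $ t $ i) * x $ t $ i" for t i
  proof -
    have "tau U * c_var p $ i \<le> c_var p $ i"
      using nn(2)[of i] tau by (intro mult_left_le_one_le) auto
    moreover have "tau U * scaling p $ i \<le> scaling p $ i * u $ t $ i"
      using nn(3)[of i] u(2)[of t i] by (subst mult.commute) (rule mult_left_mono)
    ultimately have "tau U * (c_var p $ i + scaling p $ i) \<le> c_var p $ i + scaling p $ i * u $ t $ i"
      by (simp add: distrib_left)
    then show ?thesis
      using mult_right_mono[OF _ nn(4)[of t i]] by (simp only: mult.assoc [symmetric])
  qed
  ultimately have "tau U * market_cost p z \<le> total_cost p u z"
    unfolding xy total_cost_def market_cost_def prod.case sum_distrib_left distrib_left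
    by (intro sum_mono add_mono)
  also have "\<dots> \<le> worst_case_cost p U z"
    by (rule total_cost_le_worst_case_cost[OF U u(1)])
  finally show ?thesis .
qed

lemma planner_cost_le_worst_case_cost:
  assumes "nonneg_data p" "uncertainty_set U" "z \<in> feasible p"
  shows "planner_cost p U \<le> worst_case_cost p U z"
  using planner_cost_attained[OF assms(1,2)] assms(3) by auto

lemma robust_equilibriumD:
  assumes "robust_equilibrium p z"
  shows "z \<in> feasible p" "\<And>w. w \<in> feasible p \<Longrightarrow> market_cost p z \<le> market_cost p w"
  using assms unfolding robust_equilibrium_def is_arg_min_linorder by auto

text \<open>Chain through market costs: the equilibrium \<open>z\<close> is cheapest there, so it
  can be compared with the planner's optimum \<open>w\<close>. The product form also yields
  positivity of the planner cost for the sharp instance.\<close>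

lemma tau_worst_case_cost_le_planner_cost:
  assumes p: "nonneg_data p" and U: "uncertainty_set U" and z: "robust_equilibrium p z"
  shows "tau U * worst_case_cost p U z \<le> planner_cost p U"
proof -
  obtain w where w: "w \<in> feasible p" "planner_cost p U = worst_case_cost p U w"
    using planner_cost_attained[OF p U] by blast
  have "worst_case_cost p U z \<le> market_cost p w"
    using worst_case_cost_le_market_cost[OF p U] robust_equilibriumD[OF z] w(1) order_trans by blast
  then have "tau U * worst_case_cost p U z \<le> tau U * market_cost p w"
    using tau_pos[OF U] by simp
  then show ?thesis
    using tau_market_cost_le_worst_case_cost[OF p U w(1)] w(2) by linarith
qed

section \<open>Dual weights for \<open>tau\<close>\<close>

text \<open>Minimax duality: \<open>tau U\<close> is the largest minimal entry over a convex set, so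
  some nonnegative weights \<open>A\<close> have weighted average at most \<open>tau U\<close> on
  all of \<open>U\<close>. \<open>A\<close> is left unnormalized.\<close>

lemma tau_dual_certificate:
  fixes U :: "(real ^ 'n::finite ^ 't::finite) set"
  assumes U: "uncertainty_set U"
  obtains A :: "real ^ 'n ^ 't"
  where "\<And>t i. 0 \<le> A $ t $ i" "0 < (\<Sum>t\<in>UNIV. \<Sum>i\<in>UNIV. A $ t $ i)"
    "\<And>u. u \<in> U \<Longrightarrow> A \<bullet> u \<le> tau U * (\<Sum>t\<in>UNIV. \<Sum>i\<in>UNIV. A $ t $ i)"
proof -
  define T where "T = {v :: real ^ 'n ^ 't. \<forall>t i. tau U < v $ t $ i}"
  define c :: "real \<Rightarrow> real ^ 'n ^ 't" where "c r = (\<chi> t i. r)" for r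
  have Teq: "T = (\<Inter>t. \<Inter>i. {v. tau U < (v $ t $ i)})" by (auto simp: T_def)
  have "convex {v :: real ^ 'n ^ 't. r < v $ t $ i}" for t i r
    using convex_halfspace_gt[of r "axis t (axis i (1 :: real))"] by (simp add: inner_axis')
  then have "convex T" unfolding Teq by (intro convex_INT) auto
  moreover have "convex U" using U by (simp add: uncertainty_set_def polytope_imp_convex)
  moreover have "c (tau U + 1) \<in> T" by (simp add: T_def c_def)
  moreover have "U \<inter> T = {}"
  proof (rule ccontr)
    assume "U \<inter> T \<noteq> {}"
    then obtain u where u: "u \<in> U" "\<And>t i. tau U < u $ t $ i" by (auto simp: T_def)
    \<comment> \<open>There are finitely many entries, so the least one still exceeds
      \<open>tau U\<close>, contradicting maximality.\<close>
    define m where "m = Min (range (\<lambda>(t, i). u $ t $ i))"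
    have "m \<le> u $ t $ i" for t i
      unfolding m_def by (rule Min_le) (auto intro: range_eqI[of _ _ "(t, i)"])
    moreover have "tau U < m" unfolding m_def using u by (subst Min_gr_iff) auto
    ultimately show False using tau_attained[OF U] u(1) by (meson not_le)
  qed
  moreover have "U \<noteq> {}" by (rule uncertainty_set_nonempty[OF U])
  ultimately obtain A b where A: "A \<noteq> 0" "\<And>u. u \<in> U \<Longrightarrow> A \<bullet> u \<le> b" "\<And>v. v \<in> T \<Longrightarrow> b \<le> A \<bullet> v"
    using separating_hyperplane_sets[of U T] by blast
  define S where "S = (\<Sum>t\<in>UNIV. \<Sum>i\<in>UNIV. A $ t $ i)"
  have inner_c: "A \<bullet> c r = r * S" for r
    by (simp add: c_def S_def inner_vec_def sum_distrib_left mult.commute)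
  have nn: "0 \<le> A $ t $ i" for t i
  proof (rule ccontr)
    assume neg: "\<not> 0 \<le> A $ t $ i"
    \<comment> \<open>Moving up along a coordinate stays in \<open>T\<close> but would lower the
      inner product without limit; this \<open>s\<close> brings it to at most
      \<open>b - 1\<close>.\<close>
    define s where "s = (\<bar>(tau U + 1) * S - b\<bar> + 1) / (- (A $ t $ i))"
    have s: "0 < s" "s * A $ t $ i = - (\<bar>(tau U + 1) * S - b\<bar> + 1)"
      using neg by (auto simp: s_def field_simps)
    have "c (tau U + 1) + s *\<^sub>R axis t (axis i 1) \<in> T"
      using s(1) by (auto simp: T_def c_def axis_def add_pos_pos)
    from A(3)[OF this] have "b \<le> (tau U + 1) * S + s * A $ t $ i"
      by (simp add: inner_add_right inner_c inner_axis)
    with s show False by linarith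
  qed
  have "b \<le> tau U * S"
  \<comment> \<open>The corner \<open>c (tau U)\<close> is only a limit of points of
    \<open>T\<close>, so it is approached from inside. Dividing by \<open>S + 1\<close> is safe
    before \<open>S\<close> is known to be positive.\<close>
  proof (rule field_le_epsilon)
    fix e :: real assume e: "0 < e"
    have S0: "0 \<le> S" unfolding S_def by (intro sum_nonneg nn)
    have "c (tau U + e / (S + 1)) \<in> T" using e S0 by (simp add: T_def c_def)
    from A(3)[OF this] have "b \<le> tau U * S + e * (S / (S + 1))"
      by (simp add: inner_c algebra_simps)
    also have "\<dots> \<le> tau U * S + e" using e S0 by (simp add: divide_le_eq distrib_left)
    finally show "b \<le> tau U * S + e" .
  qed
  moreover have "0 < S"
  proof -
    obtain t i where "A $ t $ i \<noteq> 0" using A(1) by (auto simp: vec_eq_iff)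
    then have "0 < A $ t $ i" using nn[of t i] by simp
    also have "A $ t $ i \<le> (\<Sum>i\<in>UNIV. A $ t $ i)" using nn by (intro member_le_sum) auto
    also have "\<dots> \<le> S"
      unfolding S_def using nn
      by (intro member_le_sum[of t UNIV "\<lambda>t. \<Sum>i\<in>UNIV. A $ t $ i"]) (auto intro: sum_nonneg)
    finally show ?thesis .
  qed
  ultimately show ?thesis using that[of A] nn A(2) unfolding S_def by force
qed

section \<open>Sharp instances\<close>

text \<open>All periods share the same factor \<open>U'\<close>, so one slice with entry 1 at
  \<open>i\<close> can be copied to every period.\<close>

lemma uncertainty_set_simultaneous_max:
  fixes U :: "(real ^ 'n::finite ^ 't::finite) set"
  assumes "uncertainty_set U"
  obtains u where "u \<in> U" "\<And>t. u $ t $ i = 1"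
proof -
  obtain U' where U': "U = {u. \<forall>t. u $ t \<in> U'}"
    using assms by (auto simp: uncertainty_set_def)
  fix t :: 't
  have "1 \<in> (\<lambda>u. u $ t $ i) ` U" using assms by (simp add: uncertainty_set_def)
  then obtain v where "v \<in> U" "v $ t $ i = 1" by auto
  then show ?thesis using that[of "\<chi> s. v $ t"] by (simp add: U')
qed

text \<open>The demand makes \<open>A\<close> itself an admissible production plan, and free
  investment makes capacity irrelevant to cost. The surcharge \<delta> makes \<open>j\<close>
  strictly cheapest for the market.\<close>

definition sharp_instance ::
  "'n \<Rightarrow> real \<Rightarrow> real ^ 'n ^ 't \<Rightarrow> ('n::finite, 't::finite) plp_data" where
  "sharp_instance j \<delta> A = \<lparr>c_inv = 0, c_var = 0, scaling = (\<chi> i. if i = j then 1 else 1 + \<delta>),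
     demand = (\<chi> t. \<Sum>i\<in>UNIV. A $ t $ i)\<rparr>"

lemma nonneg_data_sharp_instance:
  assumes "0 < \<delta>" "\<And>t i. 0 \<le> A $ t $ i"
  shows "nonneg_data (sharp_instance j \<delta> A)"
  using assms by (auto simp: nonneg_data_def sharp_instance_def intro: sum_nonneg)

lemma total_cost_sharp_instance_le:
  assumes "0 < \<delta>" "\<And>t i. 0 \<le> A $ t $ i" "\<And>t i. 0 \<le> u $ t $ i"
  shows "total_cost (sharp_instance j \<delta> A) u (A, y) \<le> (1 + \<delta>) * (A \<bullet> u)"
proof -
  have "total_cost (sharp_instance j \<delta> A) u (A, y)
      \<le> (\<Sum>i\<in>UNIV. \<Sum>t\<in>UNIV. (1 + \<delta>) * (A $ t $ i * u $ t $ i))"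
    unfolding total_cost_def prod.case
  proof (intro sum_mono)
    fix i
    have "0 \<le> A $ t $ i * u $ t $ i" for t using assms by simp
    then show "c_inv (sharp_instance j \<delta> A) $ i * y $ i + (\<Sum>t\<in>UNIV.
        (c_var (sharp_instance j \<delta> A) $ i + scaling (sharp_instance j \<delta> A) $ i * u $ t $ i) * A $ t $ i)
        \<le> (\<Sum>t\<in>UNIV. (1 + \<delta>) * (A $ t $ i * u $ t $ i))"
      using assms(1) by (auto simp: sharp_instance_def algebra_simps intro!: sum_mono)
  qed
  also have "\<dots> = (1 + \<delta>) * (A \<bullet> u)"
    by (subst sum.swap) (simp add: inner_vec_def sum_distrib_left)
  finally show ?thesis .
qed

lemma planner_cost_sharp_instance_le:
  assumes U: "uncertainty_set U" and \<delta>: "0 < \<delta>" and A: "\<And>t i. 0 \<le> A $ t $ i"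
    and bound: "\<And>u. u \<in> U \<Longrightarrow> A \<bullet> u \<le> b"
  shows "planner_cost (sharp_instance j \<delta> A) U \<le> (1 + \<delta>) * b"
proof -
  let ?p = "sharp_instance j \<delta> A"
  \<comment> \<open>Any capacity dominating \<open>A\<close> will do, since it costs
    nothing.\<close>
  define y where "y = (\<chi> i. \<Sum>t\<in>UNIV. A $ t $ i)"
  have "A $ t $ i \<le> y $ i" for t i
    unfolding y_def using A member_le_sum[of t UNIV "\<lambda>t. A $ t $ i"] by simp
  then have feas: "(A, y) \<in> feasible ?p"
    using A by (auto simp: feasible_def sharp_instance_def y_def intro: sum_nonneg)
  obtain u where u: "u \<in> U" "worst_case_cost ?p U (A, y) = total_cost ?p u (A, y)"
    using worst_case_cost_attained[OF U] by blast
  have "planner_cost ?p U \<le> total_cost ?p u (A, y)"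
    using planner_cost_le_worst_case_cost[OF nonneg_data_sharp_instance[OF \<delta> A] U feas] u by simp
  also have "\<dots> \<le> (1 + \<delta>) * (A \<bullet> u)"
    by (rule total_cost_sharp_instance_le[OF \<delta> A uncertainty_set_bounds(1)[OF U u(1)]])
  also have "\<dots> \<le> (1 + \<delta>) * b" using bound[OF u(1)] \<delta> by simp
  finally show ?thesis .
qed

text \<open>Comparison with the plan that uses \<open>j\<close> alone forces the output of
  \<open>j\<close> up to total demand; the adversary then sets every entry of \<open>j\<close> to
  1.\<close>

lemma worst_case_cost_sharp_instance_ge:
  fixes A :: "real ^ 'n::finite ^ 't::finite"
  assumes U: "uncertainty_set U" and \<delta>: "0 < \<delta>" and A: "\<And>t i. 0 \<le> A $ t $ i"
    and z: "robust_equilibrium (sharp_instance j \<delta> A) z"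
  shows "(\<Sum>t\<in>UNIV. \<Sum>i\<in>UNIV. A $ t $ i) \<le> worst_case_cost (sharp_instance j \<delta> A) U z"
proof -
  let ?p = "sharp_instance j \<delta> A"
  define D where "D t = (\<Sum>i\<in>UNIV. A $ t $ i)" for t
  have D: "0 \<le> D t" for t unfolding D_def by (intro sum_nonneg A)
  obtain x y where xy: "z = (x, y)" by force
  have feas: "z \<in> feasible ?p" using robust_equilibriumD[OF z] by simp
  then have x: "0 \<le> x $ t $ i" "(\<Sum>i\<in>UNIV. x $ t $ i) = D t" for t i
    by (auto simp: xy feasible_def sharp_instance_def D_def)
  \<comment> \<open>Once demand is met, the market cost depends only on the total output of
    \<open>j\<close>, decreasing with slope \<delta>.\<close>
  have market: "market_cost ?p (x, y) = (1 + \<delta>) * sum D UNIV - \<delta> * (\<Sum>t\<in>UNIV. x $ t $ j)"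
    if "\<And>t. (\<Sum>i\<in>UNIV. x $ t $ i) = D t" for x y
  proof -
    have "market_cost ?p (x, y) =
        (\<Sum>i\<in>UNIV. \<Sum>t\<in>UNIV. (1 + \<delta>) * x $ t $ i - (if i = j then \<delta> * x $ t $ i else 0))"
      unfolding market_cost_def prod.case sharp_instance_def
      by (intro sum.cong refl) (auto simp: algebra_simps intro: sum.cong)
    also have "\<dots> = (\<Sum>t\<in>UNIV. (1 + \<delta>) * (\<Sum>i\<in>UNIV. x $ t $ i) - \<delta> * x $ t $ j)"
      by (subst sum.swap) (simp add: sum_subtractf sum_distrib_left)
    finally show ?thesis by (simp add: that sum_subtractf sum_distrib_left)
  qed
  define x0 :: "real ^ 'n ^ 't" where "x0 = (\<chi> t i. if i = j then D t else 0)"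
  have "(x0, \<chi> i. sum D UNIV) \<in> feasible ?p"
    using D member_le_sum[of _ UNIV D]
    by (auto simp: feasible_def sharp_instance_def x0_def D_def[symmetric] intro: sum_nonneg)
  then have "market_cost ?p (x, y) \<le> market_cost ?p (x0, \<chi> i. sum D UNIV)"
    using robust_equilibriumD(2)[OF z] xy by simp
  then have "\<delta> * sum D UNIV \<le> \<delta> * (\<Sum>t\<in>UNIV. x $ t $ j)"
    using x(2) by (simp add: market x0_def)
  then have le: "sum D UNIV \<le> (\<Sum>t\<in>UNIV. x $ t $ j)" using \<delta> by simp
  obtain u where u: "u \<in> U" "\<And>t. u $ t $ j = 1"
    using uncertainty_set_simultaneous_max[OF U] by blast
  \<comment> \<open>Costs of the other producers are nonnegative and may be dropped.\<close>
  have "0 \<le> (\<Sum>t\<in>UNIV. (c_var ?p $ i + scaling ?p $ i * u $ t $ i) * x $ t $ i)" for i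
    using \<delta> x(1) uncertainty_set_bounds(1)[OF U u(1)]
    by (auto simp: sharp_instance_def intro!: sum_nonneg mult_nonneg_nonneg)
  then have "(\<Sum>t\<in>UNIV. (c_var ?p $ j + scaling ?p $ j * u $ t $ j) * x $ t $ j) \<le> 
     (\<Sum>i\<in>UNIV. \<Sum>t\<in>UNIV. (c_var ?p $ i + scaling ?p $ i * u $ t $ i) * x $ t $ i)"
    by (intro member_le_sum) auto
  then have "(\<Sum>t\<in>UNIV. x $ t $ j) \<le> total_cost ?p u z"
    by (simp add: total_cost_def xy sharp_instance_def u(2))
  also have "\<dots> \<le> worst_case_cost ?p U z"
    by (rule total_cost_le_worst_case_cost[OF U u(1)])
  finally show ?thesis using le by (simp add: D_def)
qed

text \<open>Sharpness is claimed for each \<open>U\<close> separately and for every equilibrium.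
  Positive planner cost rules out the trivial zero-demand instance, and existence of an equilibrium
  rules out vacuity.\<close>

theorem theorem4p2:
  fixes U :: "(real ^ 'n::finite ^ 't::finite) set"
  assumes "uncertainty_set U"
  shows "(\<forall>p z. nonneg_data p \<longrightarrow> robust_equilibrium p z \<longrightarrow>
            planner_cost p U \<le> worst_case_cost p U z \<and>
            worst_case_cost p U z \<le> 1 / tau U * planner_cost p U) \<and>
         (\<forall>\<delta>>0. \<exists>p. nonneg_data p \<and> planner_cost p U > 0 \<and>
            (\<exists>z. robust_equilibrium p z) \<and>
            (\<forall>z. robust_equilibrium p z \<longrightarrow>
               worst_case_cost p U z \<ge> (1 - \<delta>) / tau U * planner_cost p U))"
proof (intro conjI allI impI)
  note tau = tau_pos[OF assms]
  fix p :: "('n, 't) plp_data" and z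
  assume p: "nonneg_data p" and z: "robust_equilibrium p z"
  show "planner_cost p U \<le> worst_case_cost p U z"
    using planner_cost_le_worst_case_cost[OF p assms] robust_equilibriumD[OF z] by blast
  show "worst_case_cost p U z \<le> 1 / tau U * planner_cost p U"
    using tau_worst_case_cost_le_planner_cost[OF p assms z] tau by (simp add: field_simps)
next
  note tau = tau_pos[OF assms]
  fix \<delta> :: real assume \<delta>: "0 < \<delta>"
  obtain A :: "real ^ 'n ^ 't" where A: "\<And>t i. 0 \<le> A $ t $ i"
      "0 < (\<Sum>t\<in>UNIV. \<Sum>i\<in>UNIV. A $ t $ i)"
      "\<And>u. u \<in> U \<Longrightarrow> A \<bullet> u \<le> tau U * (\<Sum>t\<in>UNIV. \<Sum>i\<in>UNIV. A $ t $ i)"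
    using tau_dual_certificate[OF assms] by blast
  define D where "D = (\<Sum>t\<in>UNIV. \<Sum>i\<in>UNIV. A $ t $ i)"
  fix j :: 'n
  define p where "p = sharp_instance j \<delta> A"
  have p: "nonneg_data p" unfolding p_def by (rule nonneg_data_sharp_instance[OF \<delta> A(1)])
  have C: "planner_cost p U \<le> (1 + \<delta>) * (tau U * D)"
    unfolding p_def D_def by (rule planner_cost_sharp_instance_le[OF assms \<delta> A(1,3)])
  have E: "D \<le> worst_case_cost p U z" if "robust_equilibrium p z" for z
    using worst_case_cost_sharp_instance_ge[OF assms \<delta> A(1)] that unfolding p_def D_def by blast
  obtain z0 where z0: "robust_equilibrium p z0" using robust_equilibrium_exists[OF p] by blast
  \<comment> \<open>The upper bound, applied to some equilibrium, gives a positive lower bound on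
    the planner cost.\<close>
  have "0 < tau U * D" using tau A(2) by (simp add: D_def)
  also have "\<dots> \<le> tau U * worst_case_cost p U z0" using E[OF z0] tau by simp
  also have "\<dots> \<le> planner_cost p U" by (rule tau_worst_case_cost_le_planner_cost[OF p assms z0])
  finally have pos: "0 < planner_cost p U" .
  \<comment> \<open>The surcharge is absorbed by (1 - \<delta>)(1 + \<delta>) \<le> 1; for \<delta>
    > 1 the left side is already nonpositive.\<close>
  have "(1 - \<delta>) * planner_cost p U \<le> tau U * D"
  proof (cases "\<delta> \<le> 1")
    case True
    then have "(1 - \<delta>) * planner_cost p U \<le> (1 - \<delta>) * ((1 + \<delta>) * (tau U * D))"
      using C by (intro mult_left_mono) auto
    also have "\<dots> = (1 - \<delta>\<^sup>2) * (tau U * D)" by (simp add: algebra_simps power2_eq_square)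
    also have "\<dots> \<le> 1 * (tau U * D)" using \<open>0 < tau U * D\<close> by (intro mult_right_mono) auto
    finally show ?thesis by simp
  next
    case False
    then have "(1 - \<delta>) * planner_cost p U \<le> 0" using pos by (simp add: mult_nonpos_nonneg)
    with \<open>0 < tau U * D\<close> show ?thesis by linarith
  qed
  then have "(1 - \<delta>) / tau U * planner_cost p U \<le> D" using tau by (simp add: field_simps)
  then have "(1 - \<delta>) / tau U * planner_cost p U \<le> worst_case_cost p U z"
    if "robust_equilibrium p z" for z
    using E[OF that] by linarith
  with p pos z0 show "\<exists>p. nonneg_data p \<and> planner_cost p U > 0 \<and>
      (\<exists>z. robust_equilibrium p z) \<and>
      (\<forall>z. robust_equilibrium p z \<longrightarrow>
         worst_case_cost p U z \<ge> (1 - \<delta>) / tau U * planner_cost p U)"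
    by blast
qed

end
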